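(* In general, for $\mathcal I\subseteq\Pi$ and a nilpotent orbit $\mathcal O\subseteq\overline{\mathcal O}_{\mathcal I}$ in $\mathfrak{sl}_n(\mathbb C)$, the equality $\overline{\mathfrak m_{\mathcal I}\cap\mathcal O}=\mathfrak m_{\mathcal I}\cap\overline{\mathcal O}$ does not hold. Namely, it fails for $n=4$, $\mathcal I=\{\alpha_1\}$ and $\mathcal O=\mathcal O_{(2,2)}\subseteq\overline{\mathcal O}_{\mathcal I}$ (where $\mathcal O_{\mathcal I}=\mathcal O_{(3,1)}$): $$\overline{\mathfrak m_{\mathcal I}\cap\mathcal O_{(2,2)}}\neq\mathfrak m_{\mathcal I}\cap\overline{\mathcal O_{(2,2)}}.$$
   Context: $\mathfrak g=\mathfrak{sl}_n(\mathbb C)$ with simple roots $\Pi=\{\alpha_1,\dots,\alpha_{n-1}\}$, where $\alpha_i+\cdots+\alpha_{j-1}$ ($i<j$) has root space $\mathbb C e_{i,j}$. For a partition $\lambda$ of $n$, $\mathcal O_\lambda$ is the nilpotent orbit (under conjugation by $SL_n(\mathbb C)$) of matrices whose Jordan blocks have sizes the parts of $\lambda$. Closures are Zariski closures. For $\mathcal I\subseteq\Pi$, $\mathfrak m_{\mathcal I}$ is the nilradical of the standard (block upper triangular) parabolic subalgebra generated by the upper triangular traceless matrices and the root spaces $\mathbb C e_{i+1,i}$ with $\alpha_i\in\mathcal I$. $\mathcal O_{\mathcal I}$ is the Richardson orbit, i.e. the unique nilpotent orbit meeting $\mathfrak m_{\mathcal I}$ in a dense subset. *)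

theory Defs
  imports
    "HOL-Analysis.Abstract_Topology"
    "Jordan_Normal_Form.Jordan_Normal_Form"
begin

section \<open>The Lie algebra \<open>sl\<^sub>n\<close> over the complex numbers\<close>

definition sl :: "nat \<Rightarrow> complex mat set" where
  "sl n = {A \<in> carrier_mat n n. (\<Sum>i<n. A $$ (i, i)) = 0}"

definition bracket :: "complex mat \<Rightarrow> complex mat \<Rightarrow> complex mat" where
  "bracket A B = A * B - B * A"

definition linear_subspace :: "nat \<Rightarrow> complex mat set \<Rightarrow> bool" where
  "linear_subspace n V \<longleftrightarrow>
     V \<subseteq> carrier_mat n n \<and> 0\<^sub>m n n \<in> V \<and>
     (\<forall>A\<in>V. \<forall>B\<in>V. A + B \<in> V) \<and> (\<forall>c. \<forall>A\<in>V. c \<cdot>\<^sub>m A \<in> V)"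

definition lie_subalgebra :: "nat \<Rightarrow> complex mat set \<Rightarrow> bool" where
  "lie_subalgebra n L \<longleftrightarrow>
     linear_subspace n L \<and> L \<subseteq> sl n \<and> (\<forall>A\<in>L. \<forall>B\<in>L. bracket A B \<in> L)"

definition lie_ideal :: "nat \<Rightarrow> complex mat set \<Rightarrow> complex mat set \<Rightarrow> bool" where
  "lie_ideal n N L \<longleftrightarrow>
     linear_subspace n N \<and> N \<subseteq> L \<and> (\<forall>A\<in>L. \<forall>B\<in>N. bracket A B \<in> N)"

primrec lower_central :: "nat \<Rightarrow> complex mat set \<Rightarrow> nat \<Rightarrow> complex mat set" where
  "lower_central n L 0 = L"
| "lower_central n L (Suc k) =
     linear_subspace n hull {bracket A B |A B. A \<in> L \<and> B \<in> lower_central n L k}"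

definition nilpotent_lie_algebra :: "nat \<Rightarrow> complex mat set \<Rightarrow> bool" where
  "nilpotent_lie_algebra n L \<longleftrightarrow> (\<exists>k. lower_central n L k = {0\<^sub>m n n})"

definition nilradical :: "nat \<Rightarrow> complex mat set \<Rightarrow> complex mat set" where
  "nilradical n L = (GREATEST N. lie_ideal n N L \<and> nilpotent_lie_algebra n N)"


section \<open>Standard parabolic subalgebras\<close>

text \<open>Row and column indices of \<open>e\<^sub>i\<^sub>,\<^sub>j\<close> are counted from 1, whereas
  the entries of a matrix are counted from 0. The simple root \<open>\<alpha>\<^sub>i\<close> is represented
  by its index \<open>i\<close>, so \<open>\<Pi>\<close> becomes \<open>{1..<n}\<close>.\<close>

definition elem_mat :: "nat \<Rightarrow> nat \<Rightarrow> nat \<Rightarrow> complex mat" where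
  "elem_mat n i j = mat n n (\<lambda>(k, l). if Suc k = i \<and> Suc l = j then 1 else 0)"

definition simple_roots :: "nat \<Rightarrow> nat set" where
  "simple_roots n = {1..<n}"

definition parabolic :: "nat \<Rightarrow> nat set \<Rightarrow> complex mat set" where
  "parabolic n I = lie_subalgebra n hull
     ({A \<in> sl n. upper_triangular A} \<union> {c \<cdot>\<^sub>m elem_mat n (i + 1) i |c i. i \<in> I})"

definition parabolic_nilradical :: "nat \<Rightarrow> nat set \<Rightarrow> complex mat set" where
  "parabolic_nilradical n I = nilradical n (parabolic n I)"


section \<open>The Zariski topology on \<open>sl\<^sub>n\<close>\<close>

inductive_set poly_fun :: "nat \<Rightarrow> (complex mat \<Rightarrow> complex) set" for n :: nat where
  const: "(\<lambda>A. c) \<in> poly_fun n"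
| coord: "i < n \<Longrightarrow> j < n \<Longrightarrow> (\<lambda>A. A $$ (i, j)) \<in> poly_fun n"
| add: "p \<in> poly_fun n \<Longrightarrow> q \<in> poly_fun n \<Longrightarrow> (\<lambda>A. p A + q A) \<in> poly_fun n"
| mult: "p \<in> poly_fun n \<Longrightarrow> q \<in> poly_fun n \<Longrightarrow> (\<lambda>A. p A * q A) \<in> poly_fun n"

definition zariski_open :: "nat \<Rightarrow> complex mat set \<Rightarrow> bool" where
  "zariski_open n U \<longleftrightarrow> (\<exists>P \<subseteq> poly_fun n. U = sl n - {A. \<forall>p\<in>P. p A = 0})"

definition zariski :: "nat \<Rightarrow> complex mat topology" where
  "zariski n = topology (zariski_open n)"

lemma istopology_zariski: "istopology (zariski_open n)"
  unfolding istopology_def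
proof (intro conjI allI impI)
  fix S T assume "zariski_open n S" "zariski_open n T"
  then obtain P Q where P: "P \<subseteq> poly_fun n" "S = sl n - {A. \<forall>p\<in>P. p A = 0}"
    and Q: "Q \<subseteq> poly_fun n" "T = sl n - {A. \<forall>p\<in>Q. p A = 0}"
    unfolding zariski_open_def by auto
  let ?R = "(\<lambda>(p, q) A. p A * q A) ` (P \<times> Q)"
  have "?R \<subseteq> poly_fun n" using P(1) Q(1) by (auto intro!: poly_fun.mult)
  moreover have "S \<inter> T = sl n - {A. \<forall>p\<in>?R. p A = 0}"
  proof (rule Set.set_eqI)
    fix A
    have "(\<forall>r\<in>?R. r A = 0) \<longleftrightarrow> (\<forall>p\<in>P. \<forall>q\<in>Q. p A * q A = 0)" by simp
    also have "\<dots> \<longleftrightarrow> (\<forall>p\<in>P. p A = 0) \<or> (\<forall>q\<in>Q. q A = 0)"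
      unfolding mult_eq_0_iff by blast
    finally show "A \<in> S \<inter> T \<longleftrightarrow> A \<in> sl n - {A. \<forall>p\<in>?R. p A = 0}"
      unfolding P(2) Q(2) by blast
  qed
  ultimately show "zariski_open n (S \<inter> T)" unfolding zariski_open_def by blast
next
  fix K assume "\<forall>U\<in>K. zariski_open n U"
  then have "\<forall>U\<in>K. \<exists>P. P \<subseteq> poly_fun n \<and> U = sl n - {A. \<forall>p\<in>P. p A = 0}"
    unfolding zariski_open_def .
  then obtain P where P: "\<forall>U\<in>K. P U \<subseteq> poly_fun n \<and> U = sl n - {A. \<forall>p\<in>P U. p A = 0}"
    by (rule bchoice[THEN exE])
  have "(\<Union>U\<in>K. U) = (\<Union>U\<in>K. sl n - {A. \<forall>p\<in>P U. p A = 0})"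
    by (rule SUP_cong[OF refl]) (rule P[THEN bspec, THEN conjunct2])
  also have "\<dots> = sl n - {A. \<forall>p\<in>(\<Union>U\<in>K. P U). p A = 0}" by auto
  finally have "\<Union>K = sl n - {A. \<forall>p\<in>(\<Union>U\<in>K. P U). p A = 0}" by simp
  moreover have "(\<Union>U\<in>K. P U) \<subseteq> poly_fun n" using P by blast
  ultimately show "zariski_open n (\<Union>K)"
    unfolding zariski_open_def by blast
qed

lemma openin_zariski: "openin (zariski n) = zariski_open n"
  unfolding zariski_def by (simp add: istopology_zariski)

lemma topspace_zariski: "topspace (zariski n) = sl n"
proof
  show "topspace (zariski n) \<subseteq> sl n"
    unfolding topspace_def openin_zariski zariski_open_def by auto
  have "zariski_open n (sl n)"
    unfolding zariski_open_def
    by (rule exI[of _ "{\<lambda>A. 1}"]) (auto intro: poly_fun.const)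
  then show "sl n \<subseteq> topspace (zariski n)"
    unfolding topspace_def openin_zariski by auto
qed


section \<open>Nilpotent orbits\<close>

definition SL_orbit :: "complex mat \<Rightarrow> complex mat set" where
  "SL_orbit A = {B. \<exists>P Q. similar_mat_wit B A P Q \<and> det P = 1}"

definition nilpotent_orbit :: "nat \<Rightarrow> complex mat set \<Rightarrow> bool" where
  "nilpotent_orbit n Orb \<longleftrightarrow>
     (\<exists>A \<in> sl n. (\<exists>k. A ^\<^sub>m k = 0\<^sub>m n n) \<and> Orb = SL_orbit A)"

text \<open>A partition is given by the list of its parts, whose order is immaterial;
  the size of the matrices is the sum of the parts.\<close>

definition orbit_of_partition :: "nat list \<Rightarrow> complex mat set" where
  "orbit_of_partition parts = {A. jordan_nf A (map (\<lambda>k. (k, 0)) parts)}"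

definition richardson_orbit :: "nat \<Rightarrow> nat set \<Rightarrow> complex mat set" where
  "richardson_orbit n I = (THE Orb. nilpotent_orbit n Orb \<and>
     parabolic_nilradical n I
       \<subseteq> zariski n closure_of (parabolic_nilradical n I \<inter> Orb))"

end

theory Submission
  imports Defs
begin

text \<open>The nilradical for \<open>\<alpha>\<^sub>1\<close> is spanned by \<open>e\<^sub>1\<^sub>3, e\<^sub>1\<^sub>4, e\<^sub>2\<^sub>3, e\<^sub>2\<^sub>4, e\<^sub>3\<^sub>4\<close>. A matrix in it whose
  (1,3) and (3,4) entries are nonzero has Jordan type (3,1), which makes that orbit the Richardson
  orbit. A matrix in it of Jordan type (2,2) has square zero and rank 2, which forces the (3,4)
  entry to vanish; this closed condition excludes \<open>e\<^sub>3\<^sub>4\<close> from the closure of the intersection,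
  whereas \<open>e\<^sub>3\<^sub>4\<close> is the limit of the matrices \<open>e\<^sub>3\<^sub>4 + s e\<^sub>1\<^sub>2\<close> of type (2,2). All
  density statements follow by restricting polynomial functions to lines.\<close>

section \<open>Entries of 4 by 4 matrices\<close>

lemma less_4_cases: "(i::nat) < 4 \<Longrightarrow> i = 0 \<or> i = 1 \<or> i = 2 \<or> i = 3"
  by arith

lemma eq_mat4I:
  assumes "A \<in> carrier_mat 4 4" "B \<in> carrier_mat 4 4"
    "A $$ (0,0) = B $$ (0,0)" "A $$ (0,1) = B $$ (0,1)" "A $$ (0,2) = B $$ (0,2)" "A $$ (0,3) = B $$ (0,3)"
    "A $$ (1,0) = B $$ (1,0)" "A $$ (1,1) = B $$ (1,1)" "A $$ (1,2) = B $$ (1,2)" "A $$ (1,3) = B $$ (1,3)"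
    "A $$ (2,0) = B $$ (2,0)" "A $$ (2,1) = B $$ (2,1)" "A $$ (2,2) = B $$ (2,2)" "A $$ (2,3) = B $$ (2,3)"
    "A $$ (3,0) = B $$ (3,0)" "A $$ (3,1) = B $$ (3,1)" "A $$ (3,2) = B $$ (3,2)" "A $$ (3,3) = B $$ (3,3)"
  shows "A = B"
proof (rule eq_matI)
  fix i j assume "i < dim_row B" "j < dim_col B"
  then have "i < 4" "j < 4" using assms(2) by auto
  then show "A $$ (i,j) = B $$ (i,j)" using assms(3-)
    by (auto dest!: less_4_cases)
qed (use assms in auto)

lemma sum_lessThan_4: "(\<Sum>i<4. f i) = f 0 + f 1 + f 2 + (f (3::nat) :: 'a :: comm_monoid_add)"
  by (simp add: eval_nat_numeral)

text \<open>Writing out the four terms turns each matrix identity below into sixteen scalar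
  identities.\<close>

lemma mult_mat4_index:
  assumes "A \<in> carrier_mat 4 4" "B \<in> carrier_mat 4 4" "i < 4" "j < 4"
  shows "(A * B) $$ (i,j) = A $$ (i,0) * B $$ (0,j) + A $$ (i,1) * B $$ (1,j)
    + A $$ (i,2) * B $$ (2,j) + A $$ (i,3) * B $$ (3,j)"
  using assms by (simp add: scalar_prod_def lessThan_atLeast0[symmetric] sum_lessThan_4)

section \<open>Brackets and nilpotent ideals\<close>

lemma bracket_carrier [simp, intro]:
  "A \<in> carrier_mat n n \<Longrightarrow> B \<in> carrier_mat n n \<Longrightarrow> bracket A B \<in> carrier_mat n n"
  unfolding bracket_def by (intro minus_carrier_mat mult_carrier_mat)

lemma bracket_index4:
  assumes "A \<in> carrier_mat 4 4" "B \<in> carrier_mat 4 4" "i < 4" "j < 4"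
  shows "bracket A B $$ (i,j) =
    A $$ (i,0) * B $$ (0,j) + A $$ (i,1) * B $$ (1,j) + A $$ (i,2) * B $$ (2,j) + A $$ (i,3) * B $$ (3,j)
    - (B $$ (i,0) * A $$ (0,j) + B $$ (i,1) * A $$ (1,j) + B $$ (i,2) * A $$ (2,j) + B $$ (i,3) * A $$ (3,j))"
proof -
  have "bracket A B $$ (i,j) = (A * B) $$ (i,j) - (B * A) $$ (i,j)"
    unfolding bracket_def using assms by (intro index_minus_mat) auto
  then show ?thesis using assms by (simp only: mult_mat4_index)
qed

lemma trace_mult_commute:
  fixes A B :: "complex mat"
  assumes "A \<in> carrier_mat n n" "B \<in> carrier_mat n n"
  shows "(\<Sum>i<n. (A * B) $$ (i,i)) = (\<Sum>i<n. (B * A) $$ (i,i))"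
proof -
  have "(\<Sum>i<n. (A * B) $$ (i,i)) = (\<Sum>i<n. \<Sum>j<n. A $$ (i,j) * B $$ (j,i))"
    using assms by (intro sum.cong) (auto simp: scalar_prod_def lessThan_atLeast0)
  also have "\<dots> = (\<Sum>j<n. \<Sum>i<n. B $$ (j,i) * A $$ (i,j))"
    by (subst sum.swap) (simp add: mult.commute)
  also have "\<dots> = (\<Sum>i<n. (B * A) $$ (i,i))"
    using assms by (intro sum.cong) (auto simp: scalar_prod_def lessThan_atLeast0)
  finally show ?thesis .
qed

lemma bracket_in_sl:
  assumes "A \<in> carrier_mat n n" "B \<in> carrier_mat n n"
  shows "bracket A B \<in> sl n"
proof -
  have "(\<Sum>i<n. bracket A B $$ (i,i)) = (\<Sum>i<n. (A * B) $$ (i,i) - (B * A) $$ (i,i))"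
    unfolding bracket_def using assms by (intro sum.cong index_minus_mat) auto
  then show ?thesis using assms trace_mult_commute[OF assms]
    by (simp add: sl_def sum_subtractf)
qed

lemma bracket_swap:
  assumes "A \<in> carrier_mat n n" "B \<in> carrier_mat n n"
  shows "bracket A B = - 1 \<cdot>\<^sub>m bracket B A"
  unfolding bracket_def
  by (rule eq_matI) (use assms in auto)

text \<open>The first bracket with \<open>A\<close> only moves \<open>X\<close> from
  \<open>L\<close> into the ideal \<open>N\<close>; each further one descends one step of the lower
  central series. Hence \<open>Suc k\<close> brackets for index \<open>k\<close>.\<close>

lemma ad_power_in_lower_central:
  assumes N: "lie_ideal n N L" and L: "L \<subseteq> carrier_mat n n" and A: "A \<in> N" and X: "X \<in> L"
  shows "(bracket A ^^ Suc k) X \<in> lower_central n N k"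
proof (induction k)
  case 0
  have "A \<in> carrier_mat n n" "X \<in> carrier_mat n n"
    using N A X L by (auto simp: lie_ideal_def)
  \<comment> \<open>\<open>lie_ideal\<close> takes the element of \<open>L\<close> as left argument,
    so \<open>bracket A X\<close> is reached through its negative.\<close>
  moreover have "bracket X A \<in> N" using N A X by (auto simp: lie_ideal_def)
  ultimately show ?case using N bracket_swap[of A n X]
    by (auto simp: lie_ideal_def linear_subspace_def)
next
  case (Suc k)
  then show ?case using A by (auto intro!: hull_inc)
qed

text \<open>Some power of \<open>bracket A\<close> kills all of \<open>L\<close>. On the invariant
  set \<open>V\<close> the entry \<open>(i,j)\<close> is a functional that \<open>bracket A\<close>
  multiplies by \<open>c\<close>, so a power of \<open>c\<close> times a nonzero entry vanishes.
  This reads off an eigenvalue of the adjoint action without an eigenvector.\<close>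

lemma nilpotent_ideal_ad_eigenvalue:
  assumes N: "lie_ideal n N L" "nilpotent_lie_algebra n N" and L: "L \<subseteq> carrier_mat n n"
    and A: "A \<in> N" and V: "V \<subseteq> L" "X \<in> V" "X $$ (i,j) \<noteq> 0" "i < n" "j < n"
    and inv: "\<And>Y. Y \<in> V \<Longrightarrow> bracket A Y \<in> V"
    and ev: "\<And>Y. Y \<in> V \<Longrightarrow> bracket A Y $$ (i,j) = c * Y $$ (i,j)"
  shows "c = 0"
proof -
  obtain k where "lower_central n N k = {0\<^sub>m n n}"
    using N(2) by (auto simp: nilpotent_lie_algebra_def)
  moreover have "X \<in> L" using V by blast
  ultimately have 0: "(bracket A ^^ Suc k) X = 0\<^sub>m n n"
    using ad_power_in_lower_central[OF N(1) L A, of X k] by blast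
  have "(bracket A ^^ m) X \<in> V \<and> ((bracket A ^^ m) X) $$ (i,j) = c ^ m * X $$ (i,j)" for m
    by (induction m) (auto simp: V inv ev)
  from this[of "Suc k"] have "c ^ Suc k * X $$ (i,j) = 0"
    unfolding 0 using V by simp
  then have "c ^ Suc k = 0" using V by simp
  then show ?thesis by (rule power_eq_0_iff[THEN iffD1, THEN conjunct1])
qed

section \<open>The parabolic subalgebra for \<open>\<alpha>\<^sub>1\<close> and its nilradical\<close>

text \<open>The block upper triangular matrices with diagonal blocks of sizes 2, 1, 1, given by
  entries so that membership is decided by computation.\<close>

definition p_alpha1 :: "complex mat set" where
  "p_alpha1 = {A \<in> sl 4. A $$ (2,0) = 0 \<and> A $$ (2,1) = 0 \<and> A $$ (3,0) = 0 \<and> A $$ (3,1) = 0 \<and> A $$ (3,2) = 0}"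

definition m_alpha1 :: "complex mat set" where
  "m_alpha1 = {A \<in> p_alpha1. A $$ (0,0) = 0 \<and> A $$ (0,1) = 0 \<and> A $$ (1,0) = 0 \<and> A $$ (1,1) = 0
    \<and> A $$ (2,2) = 0 \<and> A $$ (3,3) = 0}"

lemma p_alpha1_carrier: "p_alpha1 \<subseteq> carrier_mat 4 4" by (auto simp: p_alpha1_def sl_def)

lemma m_alpha1_carrier: "m_alpha1 \<subseteq> carrier_mat 4 4" using p_alpha1_carrier by (auto simp: m_alpha1_def)

lemma linear_subspace_sl: "linear_subspace n (sl n)"
  by (auto simp: linear_subspace_def sl_def sum.distrib simp flip: sum_distrib_left)

lemma linear_subspace_p_alpha1: "linear_subspace 4 p_alpha1"
  using linear_subspace_sl[of 4] by (auto simp: linear_subspace_def p_alpha1_def subset_iff)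

lemma lie_subalgebra_p_alpha1: "lie_subalgebra 4 p_alpha1"
  unfolding lie_subalgebra_def
proof (intro conjI ballI linear_subspace_p_alpha1)
  show "p_alpha1 \<subseteq> sl 4" by (auto simp: p_alpha1_def)
  fix A B assume AB: "A \<in> p_alpha1" "B \<in> p_alpha1"
  then have "A \<in> carrier_mat 4 4" "B \<in> carrier_mat 4 4" using p_alpha1_carrier by auto
  then show "bracket A B \<in> p_alpha1" using AB
    by (simp add: p_alpha1_def bracket_in_sl bracket_index4)
qed

lemma upper_triangular_4:
  assumes "A \<in> carrier_mat 4 4"
  shows "upper_triangular A \<longleftrightarrow> A $$ (1,0) = 0 \<and> A $$ (2,0) = 0 \<and> A $$ (2,1) = 0
    \<and> A $$ (3,0) = 0 \<and> A $$ (3,1) = 0 \<and> A $$ (3,2) = 0"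
proof -
  have "dim_row A = Suc (Suc (Suc (Suc 0)))" using assms by simp
  then show ?thesis by (auto simp: upper_triangular_def All_less_Suc eval_nat_numeral)
qed

text \<open>For minimality, closure under addition is enough: each element is an upper triangular
  traceless matrix plus a multiple of the one generator below the diagonal.\<close>

lemma parabolic_4_1: "parabolic 4 {1} = p_alpha1"
  unfolding parabolic_def
proof (rule hull_unique)
  show "lie_subalgebra 4 p_alpha1" by (rule lie_subalgebra_p_alpha1)
next
  show "{A \<in> sl 4. upper_triangular A} \<union> {c \<cdot>\<^sub>m elem_mat 4 (i + 1) i |c i. i \<in> {1}} \<subseteq> p_alpha1"
    using upper_triangular_4
    by (auto simp: p_alpha1_def sl_def elem_mat_def sum_lessThan_4)
next
  fix T assume T: "{A \<in> sl 4. upper_triangular A} \<union> {c \<cdot>\<^sub>m elem_mat 4 (i + 1) i |c i. i \<in> {1}} \<subseteq> T"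
    and "lie_subalgebra 4 T"
  then have add: "A + B \<in> T" if "A \<in> T" "B \<in> T" for A B
    using that by (auto simp: lie_subalgebra_def linear_subspace_def)
  show "p_alpha1 \<subseteq> T"
  proof
    fix A assume A: "A \<in> p_alpha1"
    \<comment> \<open>\<open>elem_mat\<close> counts from 1, so \<open>elem_mat 4 2 1\<close> sits
      at entry \<open>(1,0)\<close>, the only place below the diagonal where \<open>A\<close> can be
      nonzero.\<close>
    let ?E = "A $$ (1,0) \<cdot>\<^sub>m elem_mat 4 (1 + 1) 1"
    have c: "A \<in> carrier_mat 4 4" "?E \<in> carrier_mat 4 4"
      using A p_alpha1_carrier by (auto simp: elem_mat_def)
    have d: "A - ?E \<in> carrier_mat 4 4" by (intro minus_carrier_mat c)
    have "A - ?E \<in> sl 4" using A c d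
      by (simp add: p_alpha1_def sl_def elem_mat_def sum_lessThan_4)
    moreover have "upper_triangular (A - ?E)" unfolding upper_triangular_4[OF d] using A c
      by (simp add: p_alpha1_def elem_mat_def)
    ultimately have "A - ?E \<in> {A \<in> sl 4. upper_triangular A}" by blast
    moreover have "?E \<in> {c \<cdot>\<^sub>m elem_mat 4 (i + 1) i |c i. i \<in> {1}}" by blast
    ultimately have "A - ?E + ?E \<in> T" using T by (intro add) blast+
    also have "A - ?E + ?E = A" using c by (intro eq_matI) (auto simp: elem_mat_def)
    finally show "A \<in> T" .
  qed
qed

lemma lie_ideal_m_alpha1: "lie_ideal 4 m_alpha1 p_alpha1"
  unfolding lie_ideal_def
proof (intro conjI ballI)
  show "linear_subspace 4 m_alpha1" using linear_subspace_p_alpha1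
    by (auto simp: linear_subspace_def m_alpha1_def)
  show "m_alpha1 \<subseteq> p_alpha1" by (auto simp: m_alpha1_def)
  fix A B assume AB: "A \<in> p_alpha1" "B \<in> m_alpha1"
  then have "A \<in> carrier_mat 4 4" "B \<in> carrier_mat 4 4" using p_alpha1_carrier m_alpha1_carrier by auto
  then show "bracket A B \<in> m_alpha1" using AB
    by (simp add: m_alpha1_def p_alpha1_def bracket_in_sl bracket_index4)
qed

lemma nilpotent_m_alpha1: "nilpotent_lie_algebra 4 m_alpha1"
proof -
  \<comment> \<open>Only the entries \<open>(0,3)\<close> and \<open>(1,3)\<close> survive in
    \<open>?Z\<close>. It contains all brackets of \<open>m_alpha1\<close> and is central there, so
    the lower central series stops after two steps.\<close>
  let ?Z = "{A \<in> m_alpha1. A $$ (0,2) = 0 \<and> A $$ (1,2) = 0 \<and> A $$ (2,3) = 0}"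
  have subspace: "linear_subspace 4 m_alpha1" using lie_ideal_m_alpha1 by (simp add: lie_ideal_def)
  have 1: "lower_central 4 m_alpha1 (Suc 0) \<subseteq> ?Z"
    unfolding lower_central.simps
  proof (rule hull_minimal)
    show "linear_subspace 4 ?Z" using subspace m_alpha1_carrier by (auto simp: linear_subspace_def subset_iff)
    have "bracket A B \<in> ?Z" if AB: "A \<in> m_alpha1" "B \<in> m_alpha1" for A B
    proof -
      have "A \<in> carrier_mat 4 4" "B \<in> carrier_mat 4 4" using AB m_alpha1_carrier by auto
      then show ?thesis using AB
        by (simp add: m_alpha1_def p_alpha1_def bracket_in_sl bracket_index4)
    qed
    then show "{bracket A B |A B. A \<in> m_alpha1 \<and> B \<in> m_alpha1} \<subseteq> ?Z" by blast
  qed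
  have "bracket A B = 0\<^sub>m 4 4" if "A \<in> m_alpha1" "B \<in> ?Z" for A B
  proof -
    have "A \<in> carrier_mat 4 4" "B \<in> carrier_mat 4 4" using that m_alpha1_carrier by auto
    then show ?thesis using that
      by (intro eq_mat4I) (auto simp: m_alpha1_def p_alpha1_def bracket_index4)
  qed
  with 1 have "{bracket A B |A B. A \<in> m_alpha1 \<and> B \<in> lower_central 4 m_alpha1 (Suc 0)} \<subseteq> {0\<^sub>m 4 4}" by blast
  then have "lower_central 4 m_alpha1 (Suc (Suc 0)) \<subseteq> {0\<^sub>m 4 4}"
    unfolding lower_central.simps(2)[of _ _ "Suc 0"]
    by (rule hull_minimal) (auto simp: linear_subspace_def)
  moreover have "0\<^sub>m 4 4 \<in> lower_central 4 m_alpha1 (Suc (Suc 0))"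
    unfolding lower_central.simps(2)[of _ _ "Suc 0"] hull_def by (auto simp: linear_subspace_def)
  ultimately show ?thesis unfolding nilpotent_lie_algebra_def by blast
qed

text \<open>Elements of a nilpotent ideal have only zero adjoint eigenvalues on the parabolic. This
  equates the diagonal entries, which then vanish because the trace does; brackets with
  \<open>E 0 1\<close> and \<open>E 1 0\<close> remove the rest of the 2 by 2 block.\<close>

lemma nilpotent_ideal_subset_m_alpha1:
  assumes N: "lie_ideal 4 N p_alpha1" "nilpotent_lie_algebra 4 N"
  shows "N \<subseteq> m_alpha1"
proof -
  note eigenvalue = nilpotent_ideal_ad_eigenvalue[OF N p_alpha1_carrier]
  have Np: "N \<subseteq> p_alpha1" using N by (simp add: lie_ideal_def)
  then have Nc: "N \<subseteq> carrier_mat 4 4" using p_alpha1_carrier by blast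
  have br: "bracket X A \<in> N" if "X \<in> p_alpha1" "A \<in> N" for X A
    using N that by (simp add: lie_ideal_def)
  define E where "E i j = mat 4 4 (\<lambda>(k,l). if k = i \<and> l = j then 1 else 0 :: complex)" for i j
  have Ec [simp]: "E i j \<in> carrier_mat 4 4" for i j by (simp add: E_def)
  have Ei: "E i j $$ (k,l) = (if k = i \<and> l = j then 1 else 0)" if "k < 4" "l < 4" for i j k l
    using that by (simp add: E_def)
  have Ep: "E 0 1 \<in> p_alpha1" "E 1 0 \<in> p_alpha1"
    by (simp_all add: p_alpha1_def sl_def sum_lessThan_4 Ei)
  \<comment> \<open>\<open>V\<close> is the line through \<open>E 0 3\<close>, the highest root
    space. It is stable under \<open>bracket A\<close> exactly when the entry
    \<open>A $$ (1,0)\<close> vanishes, hence that hypothesis in \<open>corner\<close>.\<close>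
  define V where "V = {A \<in> m_alpha1. A $$ (0,2) = 0 \<and> A $$ (1,2) = 0 \<and> A $$ (2,3) = 0 \<and> A $$ (1,3) = 0}"
  have EV: "E 0 3 \<in> V" and Em: "E 2 3 \<in> m_alpha1"
    by (simp_all add: V_def m_alpha1_def p_alpha1_def sl_def sum_lessThan_4 Ei)
  have corner: "A $$ (0,0) = A $$ (3,3)" if A: "A \<in> N" "A $$ (1,0) = 0" for A
  proof -
    have c: "A \<in> p_alpha1" "A \<in> carrier_mat 4 4" using A Nc Np by auto
    have "bracket A Y \<in> V \<and> bracket A Y $$ (0,3) = (A $$ (0,0) - A $$ (3,3)) * Y $$ (0,3)"
      if Y: "Y \<in> V" for Y
    proof -
      have "Y \<in> carrier_mat 4 4" using Y m_alpha1_carrier by (auto simp: V_def)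
      then show ?thesis using Y A c
        by (simp add: V_def m_alpha1_def p_alpha1_def bracket_in_sl bracket_index4 algebra_simps)
    qed
    then have "A $$ (0,0) - A $$ (3,3) = 0"
      by (intro eigenvalue[OF A(1), of V "E 0 3" 0 3]) (use EV in \<open>auto simp: V_def m_alpha1_def Ei\<close>)
    then show ?thesis by simp
  qed
  \<comment> \<open>Bracketing with \<open>e\<^sub>1\<^sub>2\<close> makes the Levi block upper triangular with eigenvalue \<open>A $$ (1,0)\<close>
    while clearing the last diagonal entry.\<close>
  have c0: "A $$ (1,0) = 0" if A: "A \<in> N" for A
  proof -
    have c: "A \<in> p_alpha1" "A \<in> carrier_mat 4 4" using A Nc Np by auto
    have "bracket (E 0 1) A $$ (0,0) = bracket (E 0 1) A $$ (3,3)"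
      by (rule corner[OF br[OF Ep(1) A]]) (use c in \<open>simp add: bracket_index4 Ei p_alpha1_def\<close>)
    then show ?thesis using c by (simp add: bracket_index4 Ei p_alpha1_def)
  qed
  \<comment> \<open>The \<open>(1,0)\<close> entry of \<open>bracket (E 1 0) A\<close> is the
    difference of these two diagonal entries, and it vanishes by \<open>c0\<close>.\<close>
  have ad: "A $$ (0,0) = A $$ (1,1)" if A: "A \<in> N" for A
    using c0[OF br[OF Ep(2) A]] A Nc by (simp add: bracket_index4 Ei subset_iff)
  have b0: "A $$ (0,1) = 0" if A: "A \<in> N" for A
  proof -
    \<comment> \<open>These two entries are \<open>- A $$ (0,1)\<close> and
      \<open>A $$ (0,1)\<close>, so their equality makes \<open>A $$ (0,1)\<close> zero.\<close>
    have "bracket (E 1 0) A $$ (0,0) = bracket (E 1 0) A $$ (1,1)"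
      by (rule ad[OF br[OF Ep(2) A]])
    then show ?thesis using A Nc by (simp add: bracket_index4 Ei subset_iff)
  qed
  have t: "A $$ (2,2) = A $$ (3,3)" if A: "A \<in> N" for A
  proof -
    have c: "A \<in> p_alpha1" "A \<in> carrier_mat 4 4" using A Nc Np by auto
    have "bracket A Y $$ (2,3) = (A $$ (2,2) - A $$ (3,3)) * Y $$ (2,3)"
      if Y: "Y \<in> m_alpha1" for Y
    proof -
      have "Y \<in> carrier_mat 4 4" using Y m_alpha1_carrier by auto
      then show ?thesis using Y c
        by (simp add: m_alpha1_def p_alpha1_def bracket_index4 algebra_simps)
    qed
    moreover have "bracket A Y \<in> m_alpha1" if "Y \<in> m_alpha1" for Y
      using lie_ideal_m_alpha1 c that by (simp add: lie_ideal_def)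
    ultimately have "A $$ (2,2) - A $$ (3,3) = 0"
      by (intro eigenvalue[OF A, of m_alpha1 "E 2 3" 2 3]) (use Em in \<open>auto simp: m_alpha1_def Ei\<close>)
    then show ?thesis by simp
  qed
  show ?thesis
  proof
    fix A assume A: "A \<in> N"
    then have "A \<in> p_alpha1" using Np by blast
    then have "A $$ (0,0) + A $$ (1,1) + A $$ (2,2) + A $$ (3,3) = 0"
      by (simp add: p_alpha1_def sl_def sum_lessThan_4)
    moreover note corner[OF A c0[OF A]] ad[OF A] t[OF A]
    ultimately have "A $$ (3,3) = 0" by simp
    then show "A \<in> m_alpha1" using \<open>A \<in> p_alpha1\<close> corner[OF A c0[OF A]] ad[OF A] t[OF A] b0[OF A] c0[OF A]
      by (simp add: m_alpha1_def)
  qed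
qed

lemma parabolic_nilradical_4_1: "parabolic_nilradical 4 {1} = m_alpha1"
  unfolding parabolic_nilradical_def nilradical_def parabolic_4_1
  by (rule Greatest_equality) (use lie_ideal_m_alpha1 nilpotent_m_alpha1 nilpotent_ideal_subset_m_alpha1 in auto)

section \<open>Conjugacy classes and Zariski closures\<close>

lemma similar_mat_sl:
  assumes "similar_mat A B" "B \<in> sl n"
  shows "A \<in> sl n"
proof -
  obtain m P Q where m: "{A,B,P,Q} \<subseteq> carrier_mat m m"
    and PQm: "Q * P = 1\<^sub>m m" and A: "A = P * B * Q"
    using similar_matD[OF assms(1)] by blast
  have "m = n" using m assms(2) by (auto simp: sl_def)
  then have c: "A \<in> carrier_mat n n" "B \<in> carrier_mat n n" "P \<in> carrier_mat n n" "Q \<in> carrier_mat n n"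
    and PQ: "Q * P = 1\<^sub>m n" using m PQm by auto
  have "(\<Sum>i<n. (P * (B * Q)) $$ (i,i)) = (\<Sum>i<n. ((B * Q) * P) $$ (i,i))"
    using c by (intro trace_mult_commute) auto
  moreover have "(B * Q) * P = B" using c PQ by (simp add: assoc_mult_mat[of _ n n _ n _ n])
  moreover have "A = P * (B * Q)" unfolding A using c by (intro assoc_mult_mat)
  ultimately show ?thesis using assms(2) c by (simp add: sl_def)
qed

text \<open>Scaling the conjugating matrix does not change the conjugation, and over the complex
  numbers an \<open>n\<close>-th root of \<open>inverse (det P)\<close> scales the determinant to 1.
  So orbits are full similarity classes.\<close>

lemma SL_orbit_eq:
  assumes A: "A \<in> carrier_mat n n"
  shows "SL_orbit A = {B. similar_mat B A}"
proof (intro equalityI subsetI CollectI)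
  fix B assume "B \<in> SL_orbit A"
  then show "similar_mat B A" unfolding SL_orbit_def similar_mat_def by blast
next
  fix B assume "B \<in> {B. similar_mat B A}"
  then have "similar_mat B A" by simp
  from similar_matD[OF this] obtain m P Q where m: "{B,A,P,Q} \<subseteq> carrier_mat m m"
    and PQm: "P * Q = 1\<^sub>m m" "Q * P = 1\<^sub>m m" and B: "B = P * A * Q"
    by blast
  have "m = n" using m A by auto
  then have c: "A \<in> carrier_mat n n" "B \<in> carrier_mat n n" "P \<in> carrier_mat n n" "Q \<in> carrier_mat n n"
    and PQ: "P * Q = 1\<^sub>m n" "Q * P = 1\<^sub>m n" using m PQm by auto
  have "det P * det Q = 1"
    using det_mult[of P n Q] c PQ by simp
  then have d: "det P \<noteq> 0" by force
  show "B \<in> SL_orbit A"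
  \<comment> \<open>For \<open>n = 0\<close> there is no root to choose, but the empty determinant
    is already 1.\<close>
  proof (cases "n = 0")
    case True
    then have "det P = 1" using c det_dim_zero by simp
    then show ?thesis using similar_mat_witI[OF PQ B c(2,1,3,4)]
      unfolding SL_orbit_def by blast
  next
    case False
    then have "card {z. z ^ n = inverse (det P)} = n"
      using d by (intro card_nth_roots) auto
    then have "{z. z ^ n = inverse (det P)} \<noteq> {}"
      using False by (intro notI) simp
    then obtain k where k: "k ^ n = inverse (det P)" by blast
    have "k \<noteq> 0"
    proof
      assume "k = 0"
      then show False using k d False by (simp add: power_0_left)
    qed
    have smult: "k \<cdot>\<^sub>m M * (inverse k \<cdot>\<^sub>m M') = M * M'"
      if "M \<in> carrier_mat n n" "M' \<in> carrier_mat n n" for M M'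
    proof -
      have "k \<cdot>\<^sub>m M * (inverse k \<cdot>\<^sub>m M') = inverse k \<cdot>\<^sub>m (k \<cdot>\<^sub>m (M * M'))"
        using that by (simp add: mult_smult_distrib[of _ n n _ n] mult_smult_assoc_mat[of _ n n _ n])
      also have "\<dots> = M * M'" using that \<open>k \<noteq> 0\<close> by (intro eq_matI) auto
      finally show ?thesis .
    qed
    have "similar_mat_wit B A (k \<cdot>\<^sub>m P) (inverse k \<cdot>\<^sub>m Q)"
    proof (rule similar_mat_witI[of _ _ n])
      show "k \<cdot>\<^sub>m P * (inverse k \<cdot>\<^sub>m Q) = 1\<^sub>m n" using smult[of P Q] c PQ by simp
      then show "inverse k \<cdot>\<^sub>m Q * (k \<cdot>\<^sub>m P) = 1\<^sub>m n"
        by (rule mat_mult_left_right_inverse[rotated 2]) (simp_all only: smult_carrier_mat c)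
      have "P * A \<in> carrier_mat n n" by (rule mult_carrier_mat[OF c(3,1)])
      then show "B = k \<cdot>\<^sub>m P * A * (inverse k \<cdot>\<^sub>m Q)"
        unfolding mult_smult_assoc_mat[OF c(3,1)] by (simp only: smult[OF _ c(4)] B)
    qed (simp_all only: smult_carrier_mat c)
    moreover have "det (k \<cdot>\<^sub>m P) = 1"
      unfolding det_smult carrier_matD(2)[OF c(3)] k using d by simp
    ultimately show ?thesis unfolding SL_orbit_def by blast
  qed
qed

lemma SL_orbit_cong:
  assumes "B \<in> SL_orbit A" "A \<in> carrier_mat n n"
  shows "SL_orbit B = SL_orbit A"
proof -
  have s: "similar_mat B A" using assms by (simp add: SL_orbit_eq)
  then have "B \<in> carrier_mat n n" using similar_matD[OF s] assms by auto
  then show ?thesis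
    unfolding SL_orbit_eq[OF assms(2)]
    using SL_orbit_eq similar_mat_trans s similar_mat_sym[OF s] by blast
qed

section \<open>Zariski closures via restriction to lines\<close>

lemma poly_fun_line:
  assumes "p \<in> poly_fun n" and A: "A \<in> carrier_mat n n" and E: "E \<in> carrier_mat n n"
  shows "\<exists>q. \<forall>s. p (A + s \<cdot>\<^sub>m E) = poly q s"
  using assms(1)
proof induction
  case (const c)
  show ?case by (rule exI[of _ "[:c:]"]) simp
next
  case (coord i j)
  then show ?case using A E
    by (intro exI[of _ "[:A $$ (i,j), E $$ (i,j):]"]) auto
next
  case (add p1 p2)
  then obtain q1 q2 where "\<forall>s. p1 (A + s \<cdot>\<^sub>m E) = poly q1 s" "\<forall>s. p2 (A + s \<cdot>\<^sub>m E) = poly q2 s"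
    by blast
  then show ?case by (intro exI[of _ "q1 + q2"]) simp
next
  case (mult p1 p2)
  then obtain q1 q2 where "\<forall>s. p1 (A + s \<cdot>\<^sub>m E) = poly q1 s" "\<forall>s. p2 (A + s \<cdot>\<^sub>m E) = poly q2 s"
    by blast
  then show ?case by (intro exI[of _ "q1 * q2"]) simp
qed

lemma in_zariski_closureI:
  assumes "x \<in> sl n" "S \<subseteq> sl n"
    and "\<And>p. p \<in> poly_fun n \<Longrightarrow> \<forall>y\<in>S. p y = 0 \<Longrightarrow> p x = 0"
  shows "x \<in> zariski n closure_of S"
  unfolding in_closure_of topspace_zariski openin_zariski
proof (intro conjI allI impI assms(1))
  fix T assume T: "x \<in> T \<and> zariski_open n T"
  then obtain P where P: "P \<subseteq> poly_fun n" "T = sl n - {A. \<forall>p\<in>P. p A = 0}"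
    by (auto simp: zariski_open_def)
  then obtain p where "p \<in> P" "p x \<noteq> 0" using T by blast
  with assms(3)[of p] P(1) obtain y where "y \<in> S" "p y \<noteq> 0" by blast
  then show "\<exists>y. y \<in> S \<and> y \<in> T" using P \<open>p \<in> P\<close> assms(2) by blast
qed

lemma in_zariski_closureD:
  assumes "x \<in> zariski n closure_of S" "p \<in> poly_fun n" "\<And>y. y \<in> S \<Longrightarrow> p y = 0"
  shows "p x = 0"
proof (rule ccontr)
  assume "p x \<noteq> 0"
  define T where "T = sl n - {A. \<forall>q\<in>{p}. q A = 0}"
  have "x \<in> sl n" using assms(1) by (simp add: in_closure_of topspace_zariski)
  then have "x \<in> T" using \<open>p x \<noteq> 0\<close> by (simp add: T_def)
  moreover have "zariski_open n T" unfolding T_def zariski_open_def using assms(2) by blast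
  ultimately obtain y where "y \<in> S" "y \<in> T"
    using assms(1) unfolding in_closure_of openin_zariski by blast
  then show False using assms(3) by (auto simp: T_def)
qed

text \<open>A polynomial vanishing on \<open>S\<close> restricts to a one-variable polynomial with
  infinitely many roots, hence to zero, and so vanishes at \<open>s = 0\<close> even when 0 lies in
  \<open>F\<close>.\<close>

lemma in_zariski_closure_line:
  assumes A: "A \<in> sl n" and E: "E \<in> carrier_mat n n" and S: "S \<subseteq> sl n" and F: "finite F"
    and line: "\<And>s. s \<notin> F \<Longrightarrow> A + s \<cdot>\<^sub>m E \<in> S"
  shows "A \<in> zariski n closure_of S"
proof (rule in_zariski_closureI[OF A S])
  fix p assume p: "p \<in> poly_fun n" "\<forall>y\<in>S. p y = 0"
  have A': "A \<in> carrier_mat n n" using A by (simp add: sl_def)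
  obtain q where q: "\<And>s. p (A + s \<cdot>\<^sub>m E) = poly q s"
    using poly_fun_line[OF p(1) A' E] by blast
  have "- F \<subseteq> {s. poly q s = 0}" using p(2) line by (auto simp flip: q)
  moreover have "infinite (- F)" using F by (simp add: finite_compl infinite_UNIV_char_0)
  ultimately have "q = 0" using poly_roots_finite finite_subset by blast
  then have "p (A + 0 \<cdot>\<^sub>m E) = 0" by (simp add: q)
  moreover have "A + 0 \<cdot>\<^sub>m E = A" using A' E by (intro eq_matI) auto
  ultimately show "p A = 0" by simp
qed

section \<open>Jordan representatives and their similarity classes\<close>

definition J31 :: "complex mat" where "J31 = jordan_matrix [(3,0),(1,0)]"
definition J22 :: "complex mat" where "J22 = jordan_matrix [(2,0),(2,0)]"

lemma J31_eq: "J31 = mat 4 4 (\<lambda>(i,j). if (i,j) \<in> {(0,1),(1,2)} then 1 else 0)"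
  unfolding J31_def
  using jordan_matrix_carrier[of "[(3,0),(1,0)] :: (nat \<times> complex) list"] unfolding jordan_matrix_Cons
  by (intro eq_mat4I) (simp_all del: jordan_matrix_carrier)

lemma J22_eq: "J22 = mat 4 4 (\<lambda>(i,j). if (i,j) \<in> {(0,1),(2,3)} then 1 else 0)"
  unfolding J22_def
  using jordan_matrix_carrier[of "[(2,0),(2,0)] :: (nat \<times> complex) list"] unfolding jordan_matrix_Cons
  by (intro eq_mat4I) (simp_all del: jordan_matrix_carrier)

lemma orbit_31: "orbit_of_partition [3,1] = {A. similar_mat A J31}"
  by (auto simp: orbit_of_partition_def jordan_nf_def J31_def)

lemma orbit_22: "orbit_of_partition [2,2] = {A. similar_mat A J22}"
  by (auto simp: orbit_of_partition_def jordan_nf_def J22_def)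

lemma J31_sl: "J31 \<in> sl 4" by (simp add: J31_eq sl_def sum_lessThan_4)
lemma J22_sl: "J22 \<in> sl 4" by (simp add: J22_eq sl_def sum_lessThan_4)

text \<open>For square matrices over a field a one-sided inverse is two-sided, so an explicit
  similarity needs only two product checks.\<close>

lemma similar_mat_intertwineI:
  fixes A :: "'a :: field mat"
  assumes c: "A \<in> carrier_mat n n" "B \<in> carrier_mat n n" "P \<in> carrier_mat n n" "Q \<in> carrier_mat n n"
    and PQ: "P * Q = 1\<^sub>m n" and AP: "A * P = P * B"
  shows "similar_mat A B"
proof -
  have "A = A * (P * Q)" using c PQ by simp
  also have "\<dots> = A * P * Q" using c by (simp add: assoc_mult_mat[of _ n n _ n _ n])
  also have "\<dots> = P * B * Q" unfolding AP ..
  finally have "similar_mat_wit A B P Q"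
    by (rule similar_mat_witI[OF PQ mat_mult_left_right_inverse[OF c(3,4) PQ] _ c])
  then show ?thesis by (auto simp: similar_mat_def)
qed

lemma nilpotent_orbit_31: "nilpotent_orbit 4 (orbit_of_partition [3,1])"
  and nilpotent_orbit_22: "nilpotent_orbit 4 (orbit_of_partition [2,2])"
proof -
  have c: "J31 \<in> carrier_mat 4 4" "J22 \<in> carrier_mat 4 4" using J31_sl J22_sl by (auto simp: sl_def)
  have "J31 ^\<^sub>m 3 = 0\<^sub>m 4 4"
    by (rule eq_mat4I) (use c in \<open>simp_all add: numeral_3_eq_3 mult_mat4_index del: index_mult_mat(1)\<close>,
      simp_all add: J31_eq)
  moreover have "J22 ^\<^sub>m 2 = 0\<^sub>m 4 4"
    by (rule eq_mat4I) (use c in \<open>simp_all add: numeral_2_eq_2 mult_mat4_index del: index_mult_mat(1)\<close>,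
      simp_all add: J22_eq)
  ultimately show "nilpotent_orbit 4 (orbit_of_partition [3,1])"
    "nilpotent_orbit 4 (orbit_of_partition [2,2])"
    unfolding nilpotent_orbit_def orbit_31 orbit_22 SL_orbit_eq[OF c(1), symmetric]
      SL_orbit_eq[OF c(2), symmetric]
    using J31_sl J22_sl by blast+
qed

section \<open>The orbits of type (3,1) and (2,2)\<close>

text \<open>The vector \<open>A^2 e4\<close> has nonzero first entry, so \<open>e4\<close> generates
  a Jordan chain of length 3. The kernel vector \<open>e2\<close> is independent of that chain and
  gives the block of size 1.\<close>

lemma m_alpha1_generic:
  assumes A: "A \<in> m_alpha1" "A $$ (0,2) \<noteq> 0" "A $$ (2,3) \<noteq> 0"
  shows "similar_mat A J31"
proof -
  define p q r s t where pqrst: "p = A $$ (0,2)" "q = A $$ (1,2)" "r = A $$ (0,3)" "s = A $$ (1,3)" "t = A $$ (2,3)"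
  have nz: "p \<noteq> 0" "t \<noteq> 0" using A by (simp_all add: pqrst)
  \<comment> \<open>The columns of \<open>P\<close> are \<open>A\<^sup>2 e\<^sub>4\<close>, \<open>A e\<^sub>4\<close>, \<open>e\<^sub>4\<close>, \<open>e\<^sub>2\<close>.\<close>
  define P where "P = mat_of_rows_list 4 [[t * p, r, 0, 0], [t * q, s, 0, 1], [0, t, 0, 0], [0, 0, 1, 0]]"
  define Q where "Q = mat_of_rows_list 4 [[1 / (t * p), 0, - r / (t * t * p), 0], [0, 0, 1 / t, 0],
    [0, 0, 0, 1], [- q / p, 1, r * q / (p * t) - s / t, 0]]"
  have c: "A \<in> carrier_mat 4 4" "J31 \<in> carrier_mat 4 4" "P \<in> carrier_mat 4 4" "Q \<in> carrier_mat 4 4"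
    using A m_alpha1_carrier J31_sl by (auto simp: P_def Q_def sl_def mat_of_rows_list_def)
  have PQ: "P * Q = 1\<^sub>m 4"
    by (rule eq_mat4I) (use c in \<open>simp_all add: mult_mat4_index del: index_mult_mat(1)\<close>,
      use nz in \<open>simp_all add: P_def Q_def mat_of_rows_list_def field_simps\<close>)
  have AP: "A * P = P * J31"
    by (rule eq_mat4I) (use c in \<open>simp_all add: mult_mat4_index del: index_mult_mat(1)\<close>,
      use A in \<open>simp_all add: P_def J31_eq mat_of_rows_list_def m_alpha1_def p_alpha1_def pqrst\<close>)
  show ?thesis by (rule similar_mat_intertwineI[OF c PQ AP])
qed

text \<open>A direction inside \<open>m_alpha1\<close> that moves exactly the two entries required
  to be nonzero in \<open>m_alpha1_generic\<close>. A line in this direction through a point of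
  \<open>m_alpha1\<close> has type (3,1) for all but at most two parameters.\<close>

definition E02_23 :: "complex mat" where
  "E02_23 = mat 4 4 (\<lambda>(i,j). if (i,j) \<in> {(0,2),(2,3)} then 1 else 0)"

lemma m_alpha1_line_generic:
  assumes A: "A \<in> m_alpha1" and s: "s \<notin> {- A $$ (0,2), - A $$ (2,3)}"
  shows "A + s \<cdot>\<^sub>m E02_23 \<in> m_alpha1 \<and> similar_mat (A + s \<cdot>\<^sub>m E02_23) J31"
proof -
  have E: "E02_23 \<in> m_alpha1" by (simp add: E02_23_def m_alpha1_def p_alpha1_def sl_def sum_lessThan_4)
  then have "A + s \<cdot>\<^sub>m E02_23 \<in> m_alpha1"
    using A lie_ideal_m_alpha1 by (simp add: lie_ideal_def linear_subspace_def)
  moreover have "(A + s \<cdot>\<^sub>m E02_23) $$ (0,2) \<noteq> 0" "(A + s \<cdot>\<^sub>m E02_23) $$ (2,3) \<noteq> 0"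
    using s by (auto simp: E02_23_def add_eq_0_iff2)
  ultimately show ?thesis using m_alpha1_generic by blast
qed

lemma orbit_31_sl: "orbit_of_partition [3,1] \<subseteq> sl 4"
  and orbit_22_sl: "orbit_of_partition [2,2] \<subseteq> sl 4"
  unfolding orbit_31 orbit_22 using similar_mat_sl J31_sl J22_sl by blast+

lemma m_alpha1_sl: "m_alpha1 \<subseteq> sl 4" by (auto simp: m_alpha1_def p_alpha1_def)

section \<open>The Richardson orbit and its closure\<close>

lemma m_alpha1_subset_closure: "m_alpha1 \<subseteq> zariski 4 closure_of (m_alpha1 \<inter> orbit_of_partition [3,1])"
proof
  fix A assume A: "A \<in> m_alpha1"
  show "A \<in> zariski 4 closure_of (m_alpha1 \<inter> orbit_of_partition [3,1])"
  proof (rule in_zariski_closure_line)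
    show "A \<in> sl 4" "m_alpha1 \<inter> orbit_of_partition [3,1] \<subseteq> sl 4" using A m_alpha1_sl by auto
    show "E02_23 \<in> carrier_mat 4 4" by (simp add: E02_23_def)
    show "finite {- A $$ (0,2), - A $$ (2,3)}" by simp
    show "A + s \<cdot>\<^sub>m E02_23 \<in> m_alpha1 \<inter> orbit_of_partition [3,1]"
      if "s \<notin> {- A $$ (0,2), - A $$ (2,3)}" for s
      using m_alpha1_line_generic[OF A that] unfolding orbit_31 by blast
  qed
qed

lemma richardson_orbit_4_1: "richardson_orbit 4 {1} = orbit_of_partition [3,1]"
  unfolding richardson_orbit_def parabolic_nilradical_4_1
proof (rule the_equality)
  show "nilpotent_orbit 4 (orbit_of_partition [3,1]) \<and>
    m_alpha1 \<subseteq> zariski 4 closure_of (m_alpha1 \<inter> orbit_of_partition [3,1])"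
    using nilpotent_orbit_31 m_alpha1_subset_closure by simp
next
  fix Orb assume Orb: "nilpotent_orbit 4 Orb \<and> m_alpha1 \<subseteq> zariski 4 closure_of (m_alpha1 \<inter> Orb)"
  \<comment> \<open>This polynomial is nonzero at \<open>E02_23\<close>, so an orbit dense in
    \<open>m_alpha1\<close> has a point in \<open>m_alpha1\<close> where both factors are nonzero.
    Such a point has type (3,1), and orbits sharing a point coincide.\<close>
  let ?f = "\<lambda>A :: complex mat. A $$ (0,2) * A $$ (2,3)"
  have "E02_23 \<in> m_alpha1" "?f E02_23 \<noteq> 0"
    by (simp_all add: E02_23_def m_alpha1_def p_alpha1_def sl_def sum_lessThan_4)
  moreover have "?f \<in> poly_fun 4" by (intro poly_fun.mult poly_fun.coord) auto
  ultimately have "\<not> (\<forall>A\<in>m_alpha1 \<inter> Orb. ?f A = 0)"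
    using Orb in_zariski_closureD[of E02_23 4 "m_alpha1 \<inter> Orb" ?f] by blast
  then obtain A where A: "A \<in> m_alpha1" "A \<in> Orb" "A $$ (0,2) \<noteq> 0" "A $$ (2,3) \<noteq> 0" by auto
  have J: "J31 \<in> carrier_mat 4 4" using J31_sl by (simp add: sl_def)
  have "A \<in> SL_orbit J31"
    using m_alpha1_generic[OF A(1,3,4)] by (simp add: SL_orbit_eq[OF J])
  from SL_orbit_cong[OF this J] have "SL_orbit A = orbit_of_partition [3,1]"
    unfolding orbit_31 SL_orbit_eq[OF J] .
  moreover obtain B where B: "B \<in> sl 4" "Orb = SL_orbit B"
    using Orb by (auto simp: nilpotent_orbit_def)
  moreover have "SL_orbit A = SL_orbit B"
    using A(2) B by (intro SL_orbit_cong[of A B 4]) (simp_all add: sl_def)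
  ultimately show "Orb = orbit_of_partition [3,1]" by simp
qed

text \<open>The class of type (2,2) has a representative \<open>R\<close> in
  \<open>m_alpha1\<close>, and \<open>R + s E02_23\<close> has type (3,1) for almost all
  \<open>s\<close>. Conjugating this whole line carries the statement to every matrix of type
  (2,2).\<close>

lemma orbit_22_subset_closure:
  "orbit_of_partition [2,2] \<subseteq> zariski 4 closure_of orbit_of_partition [3,1]"
proof
  fix A assume A: "A \<in> orbit_of_partition [2,2]"
  define R :: "complex mat" where "R = mat 4 4 (\<lambda>(i,j). if (i,j) \<in> {(0,2),(1,3)} then 1 else 0)"
  \<comment> \<open>The permutation matrix exchanging the two middle basis vectors; it is its own
    inverse and conjugates \<open>J22\<close> into \<open>R\<close>.\<close>
  define T :: "complex mat" where "T = mat 4 4 (\<lambda>(i,j). if (i,j) \<in> {(0,0),(1,2),(2,1),(3,3)} then 1 else 0)"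
  have c: "R \<in> carrier_mat 4 4" "J22 \<in> carrier_mat 4 4" "T \<in> carrier_mat 4 4"
    using J22_sl by (simp_all add: R_def T_def sl_def)
  have TT: "T * T = 1\<^sub>m 4"
    by (rule eq_mat4I) (use c in \<open>simp_all add: mult_mat4_index del: index_mult_mat(1)\<close>,
      simp_all add: T_def)
  have RT: "R * T = T * J22"
    by (rule eq_mat4I) (use c in \<open>simp_all add: mult_mat4_index del: index_mult_mat(1)\<close>,
      simp_all add: T_def R_def J22_eq)
  have R: "R \<in> m_alpha1" by (simp add: R_def m_alpha1_def p_alpha1_def sl_def sum_lessThan_4)
  have "similar_mat R J22" by (rule similar_mat_intertwineI[OF c(1,2,3,3) TT RT])
  then have "similar_mat A R" using A similar_mat_trans similar_mat_sym
    unfolding orbit_22 by blast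
  from similar_matD[OF this] obtain m P Q where m: "{A,R,P,Q} \<subseteq> carrier_mat m m"
    and PQ: "P * Q = 1\<^sub>m m" "Q * P = 1\<^sub>m m" "A = P * R * Q"
    by blast
  have [simp]: "m = 4" using m c by auto
  have E: "E02_23 \<in> carrier_mat 4 4" by (simp add: E02_23_def)
  show "A \<in> zariski 4 closure_of orbit_of_partition [3,1]"
  proof (rule in_zariski_closure_line)
    show "A \<in> sl 4" using A orbit_22_sl by blast
    show "P * E02_23 * Q \<in> carrier_mat 4 4" using m E by auto
    show "finite {- R $$ (0,2), - R $$ (2,3)}" by simp
    fix s assume s: "s \<notin> {- R $$ (0,2), - R $$ (2,3)}"
    have c': "P \<in> carrier_mat 4 4" "Q \<in> carrier_mat 4 4" using m by auto
    have "P * (R + s \<cdot>\<^sub>m E02_23) * Q = (P * R + s \<cdot>\<^sub>m (P * E02_23)) * Q"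
      using c(1) c'(1) E by (simp add: mult_add_distrib_mat[of _ 4 4 _ 4] mult_smult_distrib[of _ 4 4 _ 4])
    also have "\<dots> = P * R * Q + s \<cdot>\<^sub>m (P * E02_23) * Q"
      using c(1) c' E by (intro add_mult_distrib_mat[of _ 4 4]) auto
    also have "s \<cdot>\<^sub>m (P * E02_23) * Q = s \<cdot>\<^sub>m (P * E02_23 * Q)"
      using c' E by (intro mult_smult_assoc_mat[of _ 4 4]) auto
    finally have "P * (R + s \<cdot>\<^sub>m E02_23) * Q = P * R * Q + s \<cdot>\<^sub>m (P * E02_23 * Q)" .
    then have eq: "A + s \<cdot>\<^sub>m (P * E02_23 * Q) = P * (R + s \<cdot>\<^sub>m E02_23) * Q" using PQ by simp
    have "similar_mat_wit (A + s \<cdot>\<^sub>m (P * E02_23 * Q)) (R + s \<cdot>\<^sub>m E02_23) P Q"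
      by (rule similar_mat_witI[of _ _ 4, OF _ _ eq]) (use m E c' PQ(1,2) in auto)
    then have "similar_mat (A + s \<cdot>\<^sub>m (P * E02_23 * Q)) (R + s \<cdot>\<^sub>m E02_23)"
      by (auto simp: similar_mat_def)
    then show "A + s \<cdot>\<^sub>m (P * E02_23 * Q) \<in> orbit_of_partition [3,1]"
      using m_alpha1_line_generic[OF R s] similar_mat_trans unfolding orbit_31 by blast
  qed (rule orbit_31_sl)
qed

text \<open>Type (2,2) forces \<open>A * A = 0\<close>. If the entry \<open>(2,3)\<close> were
  nonzero, the third column would vanish and only the last column could survive, giving rank at most
  1 instead of 2.\<close>

lemma m_alpha1_orbit_22:
  assumes A: "A \<in> m_alpha1" and sim: "similar_mat A J22"
  shows "A $$ (2,3) = 0"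
proof (rule ccontr)
  assume nz: "A $$ (2,3) \<noteq> 0"
  from similar_matD[OF sim] obtain m P Q where m: "{A,J22,P,Q} \<subseteq> carrier_mat m m"
    and PQ: "P * Q = 1\<^sub>m m" "Q * P = 1\<^sub>m m" "A = P * J22 * Q"
    by blast
  have [simp]: "m = 4" using m m_alpha1_carrier A by auto
  have c: "A \<in> carrier_mat 4 4" "J22 \<in> carrier_mat 4 4" "P \<in> carrier_mat 4 4" "Q \<in> carrier_mat 4 4"
    using m by auto
  note assoc = assoc_mult_mat[of _ 4 4 _ 4 _ 4]
  have JJ: "J22 * J22 = 0\<^sub>m 4 4"
    by (rule eq_mat4I) (use c in \<open>simp_all add: mult_mat4_index del: index_mult_mat(1)\<close>,
      simp_all add: J22_eq)
  have AP: "A * P = P * J22"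
  proof -
    have "A * P = P * J22 * (Q * P)" using c by (simp add: PQ(3) assoc)
    also have "\<dots> = P * J22" using c PQ(2) by (simp add: assoc)
    finally show ?thesis .
  qed
  have "A * A = A * P * J22 * Q"
    unfolding PQ(3)[THEN arg_cong, of "(*) A"] using c by (simp add: assoc)
  also have "\<dots> = P * (J22 * J22) * Q" unfolding AP using c by (simp add: assoc)
  also have "\<dots> = 0\<^sub>m 4 4" using c JJ by simp
  finally have AA: "A * A = 0\<^sub>m 4 4" .
  have "(A * A) $$ (0,3) = 0" "(A * A) $$ (1,3) = 0" unfolding AA by simp_all
  then have "A $$ (0,2) = 0" "A $$ (1,2) = 0"
    using A c nz by (simp_all add: mult_mat4_index m_alpha1_def p_alpha1_def del: index_mult_mat(1))
  then have col: "A $$ (i,j) = 0" if "i < 4" "j < 3" for i j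
    using A that by (auto simp: m_alpha1_def p_alpha1_def less_Suc_eq eval_nat_numeral)
  have J: "J22 = Q * (A * P)"
  proof -
    have "Q * (A * P) = (Q * P) * J22" unfolding AP using c by (simp add: assoc)
    then show ?thesis using c PQ(2) by simp
  qed
  have APc: "A * P \<in> carrier_mat 4 4" by (rule mult_carrier_mat[OF c(1,3)])
  \<comment> \<open>\<open>v\<close> is \<open>Q\<close> applied to the last column of
    \<open>A\<close>. It exhibits \<open>J22\<close> as an outer product of \<open>v\<close> with
    the last row of \<open>P\<close>, the explicit form of rank at most 1.\<close>
  define v where "v i = Q $$ (i,0) * A $$ (0,3) + Q $$ (i,1) * A $$ (1,3) + Q $$ (i,2) * A $$ (2,3)
      + Q $$ (i,3) * A $$ (3,3)" for i
  have "J22 $$ (i,j) = v i * P $$ (3,j)" if "i < 4" "j < 4" for i j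
  proof -
    have AP: "(A * P) $$ (l,j) = A $$ (l,3) * P $$ (3,j)" if "l < 4" for l
      unfolding mult_mat4_index[OF c(1,3) that \<open>j < 4\<close>] using that by (simp add: col)
    show ?thesis
      unfolding J mult_mat4_index[OF c(4) APc that] v_def by (simp add: AP distrib_right mult.assoc del: index_mult_mat(1))
  qed
  \<comment> \<open>The ones at \<open>(0,1)\<close> and \<open>(2,3)\<close> make
    \<open>v 0\<close> and \<open>P $$ (3,3)\<close> nonzero, while their product is the zero entry
    \<open>(0,3)\<close>.\<close>
  from this[of 0 1] this[of 2 3] this[of 0 3] show False by (auto simp: J22_eq)
qed

text \<open>The separating point is \<open>E 2 3\<close>, of rank 1. It is approached within type
  (2,2) only by leaving \<open>m_alpha1\<close>, here in the direction \<open>E 0 1\<close>.\<close>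

lemma closures_differ:
  "zariski 4 closure_of (m_alpha1 \<inter> orbit_of_partition [2,2])
    \<noteq> m_alpha1 \<inter> zariski 4 closure_of orbit_of_partition [2,2]"
proof -
  define E where "E i j = mat 4 4 (\<lambda>(k,l). if k = i \<and> l = j then 1 else 0 :: complex)" for i j
  have Em: "E 2 3 \<in> m_alpha1" and E01: "E 0 1 \<in> carrier_mat 4 4"
    by (simp_all add: E_def m_alpha1_def p_alpha1_def sl_def sum_lessThan_4)
  have "E 2 3 \<in> zariski 4 closure_of orbit_of_partition [2,2]"
  proof (rule in_zariski_closure_line[OF _ E01 orbit_22_sl])
    show "E 2 3 \<in> sl 4" using Em m_alpha1_sl by blast
    show "finite {0}" by simp
    fix s :: complex assume s: "s \<notin> {0}"
    \<comment> \<open>Rescaling the first basis vector by \<open>s\<close> turns the coefficient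
      \<open>s\<close> at \<open>(0,1)\<close> into the 1 of \<open>J22\<close>; this needs
      \<open>s\<close> nonzero.\<close>
    define D where "D x = mat 4 4 (\<lambda>(i,j). if i = j then if i = 0 then x else 1 else 0 :: complex)" for x
    have c: "E 2 3 + s \<cdot>\<^sub>m E 0 1 \<in> carrier_mat 4 4" "J22 \<in> carrier_mat 4 4"
      "D s \<in> carrier_mat 4 4" "D (1 / s) \<in> carrier_mat 4 4"
      using J22_sl by (simp_all add: E_def D_def sl_def)
    have DD: "D s * D (1 / s) = 1\<^sub>m 4"
      by (rule eq_mat4I) (use c in \<open>simp_all add: mult_mat4_index del: index_mult_mat(1)\<close>,
        use s in \<open>simp_all add: D_def\<close>)
    have "(E 2 3 + s \<cdot>\<^sub>m E 0 1) * D s = D s * J22"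
      by (rule eq_mat4I) (use c in \<open>simp_all add: mult_mat4_index del: index_mult_mat(1) index_add_mat(1)\<close>,
        simp_all add: D_def E_def J22_eq)
    then show "E 2 3 + s \<cdot>\<^sub>m E 0 1 \<in> orbit_of_partition [2,2]"
      unfolding orbit_22 using similar_mat_intertwineI[OF c DD] by simp
  qed
  moreover have "E 2 3 \<notin> zariski 4 closure_of (m_alpha1 \<inter> orbit_of_partition [2,2])"
  proof
    assume "E 2 3 \<in> zariski 4 closure_of (m_alpha1 \<inter> orbit_of_partition [2,2])"
    then have "E 2 3 $$ (2,3) = 0"
      by (rule in_zariski_closureD) (auto intro: poly_fun.coord m_alpha1_orbit_22 simp: orbit_22)
    then show False by (simp add: E_def)
  qed
  ultimately show ?thesis using Em by blast
qed

theorem mainTheorem3: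
  shows
   "\<not> (\<forall>n I Orb. 2 \<le> n \<and> I \<subseteq> simple_roots n \<and> nilpotent_orbit n Orb \<and>
              Orb \<subseteq> zariski n closure_of richardson_orbit n I \<longrightarrow>
              zariski n closure_of (parabolic_nilradical n I \<inter> Orb)
                = parabolic_nilradical n I \<inter> zariski n closure_of Orb) \<and>
    nilpotent_orbit 4 (orbit_of_partition [2, 2]) \<and>
    richardson_orbit 4 {1} = orbit_of_partition [3, 1] \<and>
    orbit_of_partition [2, 2] \<subseteq> zariski 4 closure_of richardson_orbit 4 {1} \<and>
    zariski 4 closure_of (parabolic_nilradical 4 {1} \<inter> orbit_of_partition [2, 2])
           \<noteq> parabolic_nilradical 4 {1} \<inter> zariski 4 closure_of orbit_of_partition [2, 2]"
proof -
  \<comment> \<open>The concrete case also refutes the universal equality, so its side conditions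
    are collected here.\<close>
  have "{1} \<subseteq> simple_roots 4" by (simp add: simple_roots_def)
  moreover have "(2::nat) \<le> 4" by simp
  moreover note nilpotent_orbit_22
  moreover have "orbit_of_partition [2, 2] \<subseteq> zariski 4 closure_of richardson_orbit 4 {1}"
    unfolding richardson_orbit_4_1 by (rule orbit_22_subset_closure)
  moreover note richardson_orbit_4_1
  moreover note closures_differ[folded parabolic_nilradical_4_1]
  ultimately show ?thesis by blast
qed

end
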